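(* Let $A=[a_{ij}]\in\mathcal{M}_n(\mathbb{C})$ and let $m\ge 1$ be an integer. Then: (1) $w(A^{\circ m})\le w(A)\,\|A\|^{m-1}\le 2^{m-1}w(A)^m$. (2) Moreover, if $w(A)=\|A\|$ (e.g. if $A$ is normal), then $w(A^{\circ m})\le w(A)^m$. (3) If $w(A)=\|A\|$ and $w(A^{\circ m})=w(A)^m$ for some $m\ge 1$, then (for this $m$) $$w(A^{\circ m})=\|A^{\circ m}\|=\|A\|^m=w(A)^m.$$
   Context: For a complex square matrix $A$, $\|A\|$ is the spectral norm (operator norm with respect to the Euclidean norm) and $w(A)=\sup\{|\langle Ax,x\rangle| : \|x\|=1\}$ is the numerical radius. $A^{\circ m}=[a_{ij}^m]$ is the entrywise (Schur/Hadamard) $m$-th power of $A=[a_{ij}]$. *)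

theory Defs
  imports "HOL-Analysis.Analysis"
begin

(* The library's inner product on complex^'n is the real-valued one (the real part of the
   form below), so the complex sesquilinear form, linear in the first argument, is defined here.
   The norm of the type complex^'n is already the Euclidean norm on C^n. *)
definition cinner :: "complex ^ 'n \<Rightarrow> complex ^ 'n \<Rightarrow> complex" where
  "cinner x y = (\<Sum>i\<in>UNIV. x $ i * cnj (y $ i))"

definition spectral_norm :: "complex ^ 'n ^ 'n \<Rightarrow> real" where
  "spectral_norm A = onorm (\<lambda>x. A *v x)"

definition numerical_radius :: "complex ^ 'n ^ 'n \<Rightarrow> real" where
  "numerical_radius A = (SUP x\<in>{x. norm x = 1}. cmod (cinner (A *v x) x))"

definition hadamard_power :: "complex ^ 'n ^ 'n \<Rightarrow> nat \<Rightarrow> complex ^ 'n ^ 'n" where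
  "hadamard_power A m = map_matrix (\<lambda>a. a ^ m) A"

definition conj_transpose :: "complex ^ 'n ^ 'n \<Rightarrow> complex ^ 'n ^ 'n" where
  "conj_transpose A = map_matrix cnj (transpose A)"

definition normal_matrix :: "complex ^ 'n ^ 'n \<Rightarrow> bool" where
  "normal_matrix A \<longleftrightarrow> A ** conj_transpose A = conj_transpose A ** A"

end

theory Submission
  imports Defs
begin

text \<open>
  Write \<open>A \<circ> B\<close> for the entrywise product and \<open>A^(m)\<close> for the entrywise power.
  Since \<open>A^(m) = A \<circ> A^(m - 1)\<close>, the first inequality follows from
  \<open>w(A \<circ> B) \<le> w(A) \<parallel>B\<parallel>\<close> (\<open>numerical_radius_hadamard_le\<close>) together with the submultiplicativity
  \<open>\<parallel>A \<circ> B\<parallel> \<le> \<parallel>A\<parallel> \<parallel>B\<parallel>\<close> (\<open>spectral_norm_hadamard_le\<close>), the second one from \<open>\<parallel>A\<parallel> \<le> 2 w(A)\<close>. The case of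
  equality then comes from the chain \<open>w(A^(m)) \<le> \<parallel>A^(m)\<parallel> \<le> \<parallel>A\<parallel>^m = w(A)^m\<close>, whose ends agree.

  The bounds of other quantities by \<open>w(A)\<close> rest on one inequality for a finite sequence of vectors
  \<open>g 0, \<dots>, g N\<close> (\<open>cmod_sum_shift_le\<close>):
  \<open>\<bar>\<Sum>k<N. \<langle>A (g (k + 1)), g k\<rangle>\<bar> \<le> w(A) (\<Sum>k\<le>N. \<parallel>g k\<parallel>\<^sup>2)\<close>.
  It is obtained by testing the quadratic form of \<open>A\<close> on the vectors \<open>\<Sum>k\<le>N. \<zeta>^(-k) (g k)\<close> and
  averaging, with weight \<open>\<zeta>\<close>, over the roots of unity \<open>\<zeta>\<close>. Its instances are:

  \<^item> \<open>N = 1\<close>, with \<open>g 1\<close> a unit vector on which the spectral norm is attained and \<open>g 0\<close> the normalised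
    image of \<open>g 1\<close>: this is \<open>\<parallel>A\<parallel> \<le> 2 w(A)\<close>.

  \<^item> \<open>g k\<close> a multiple of the iterate of \<open>A\<close> of order \<open>N - k\<close> at \<open>x\<close>, where \<open>A\<close> is
    normal and \<open>x\<close> is such a unit vector. Then the iterates of order \<open>k\<close> have norm \<open>\<parallel>A\<parallel>^k\<close>, and
    letting \<open>N\<close> grow gives \<open>\<parallel>A\<parallel> \<le> w(A)\<close> without diagonalising \<open>A\<close>.

  \<^item> vectors built from the ordinary powers of an isometry \<open>U\<close>. As \<open>\<langle>U^(k + 1) e\<^sub>j, U^k e\<^sub>i\<rangle>\<close> is the
    entry of \<open>U\<close> at \<open>(i, j)\<close> for every \<open>k\<close>, each of the \<open>N\<close> summands equals
    \<open>\<langle>(A \<circ> U) x, x\<rangle>\<close>, whence \<open>w(A \<circ> U) \<le> w(A)\<close>.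

  The last instance extends from isometries to all contractions by convexity: the extreme points of
  the unit ball of the spectral norm are isometries (\<open>extreme_contraction_isometry\<close>), so by the
  Krein-Milman theorem every contraction is a convex combination of isometries.
\<close>

section \<open>The Hermitian form, the spectral norm and the numerical radius\<close>

lemma cinner_scale_left: "cinner (c *s x) y = c * cinner x y"
  by (simp add: cinner_def sum_distrib_left mult.assoc)

lemma cinner_scale_right: "cinner x (c *s y) = cnj c * cinner x y"
  by (simp add: cinner_def sum_distrib_left mult_ac)

lemma cinner_sum_left: "cinner (\<Sum>k\<in>K. f k) y = (\<Sum>k\<in>K. cinner (f k) y)"
  unfolding cinner_def sum_component sum_distrib_right by (rule sum.swap)

lemma cinner_sum_right: "cinner x (\<Sum>k\<in>K. f k) = (\<Sum>k\<in>K. cinner x (f k))"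
  unfolding cinner_def sum_component cnj_sum sum_distrib_left by (rule sum.swap)

lemma cnj_cinner: "cnj (cinner x y) = cinner y x"
  by (simp add: cinner_def mult.commute)

lemma Re_cinner: "Re (cinner x y) = inner x y"
  by (simp add: cinner_def inner_vec_def inner_complex_def)

lemma norm_power2_vec: "(norm x)\<^sup>2 = (\<Sum>i\<in>UNIV. (norm (x $ i))\<^sup>2)"
  by (simp add: norm_vec_def L2_set_def sum_nonneg)

lemma cinner_self: "cinner x x = of_real ((norm x)\<^sup>2)"
  by (simp add: cinner_def norm_power2_vec flip: complex_norm_square)

lemma norm_vector_scalar_mult: "norm (c *s x) = cmod c * norm (x :: complex ^ 'n)"
proof -
  have "(norm (c *s x))\<^sup>2 = (cmod c * norm x)\<^sup>2"
    by (simp add: norm_power2_vec power_mult_distrib norm_mult sum_distrib_left)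
  then show ?thesis
    by (simp)
qed

lemma cinner_Cauchy_Schwarz: "cmod (cinner x y) \<le> norm x * norm y"
proof (cases "cinner x y = 0")
  case False
  \<comment> \<open>Rotating \<open>x\<close> by a phase makes the form real, where it is the real inner product.\<close>
  define c where "c = cnj (cinner x y) / cmod (cinner x y)"
  have "cmod c = 1"
    using False by (simp add: c_def norm_divide)
  have "c * cinner x y = cmod (cinner x y)"
    using False complex_norm_square[of "cinner x y"]
    by (simp add: c_def field_simps power2_eq_square)
  then have "cmod (cinner x y) = inner (c *s x) y"
    by (metis Re_cinner Re_complex_of_real cinner_scale_left)
  also have "\<dots> \<le> norm (c *s x) * norm y"
    by (rule norm_cauchy_schwarz)
  finally show ?thesis
    by (simp add: norm_vector_scalar_mult \<open>cmod c = 1\<close>)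
qed simp

lemma matrix_vector_sum: "A *v (\<Sum>k\<in>K. f k) = (\<Sum>k\<in>K. A *v f k)"
  for A :: "complex ^ 'n ^ 'm"
  by (rule linear_sum) simp

lemma cinner_matrix_vector:
  "cinner (A *v x) y = (\<Sum>i\<in>UNIV. \<Sum>j\<in>UNIV. A $ i $ j * x $ j * cnj (y $ i))"
  by (simp add: cinner_def matrix_vector_mult_def sum_distrib_right)

lemma cinner_conj_transpose: "cinner (A *v x) y = cinner x (conj_transpose A *v y)"
  unfolding cinner_matrix_vector
  by (subst sum.swap)
    (simp add: cinner_def matrix_vector_mult_def conj_transpose_def map_matrix_def transpose_def
      sum_distrib_left mult_ac)

lemma norm_matrix_vector_le: "norm (A *v x) \<le> spectral_norm A * norm x"
  unfolding spectral_norm_def by (rule onorm) simp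

lemma spectral_norm_nonneg: "0 \<le> spectral_norm A"
  unfolding spectral_norm_def by (rule onorm_pos_le) simp

lemma spectral_norm_le: "(\<And>x. norm (A *v x) \<le> b * norm x) \<Longrightarrow> spectral_norm A \<le> b"
  unfolding spectral_norm_def by (rule onorm_le)

lemma norm_axis_one: "norm (axis i (1 :: complex)) = 1"
  by (simp add: norm_eq_sqrt_inner inner_axis_axis)

lemma exists_unit_vector: "\<exists>x :: complex ^ 'n. norm x = 1"
  using norm_axis_one by blast

lemma spectral_norm_attained: "\<exists>x. norm x = 1 \<and> norm (A *v x) = spectral_norm A"
proof -
  have "sphere 0 1 \<noteq> ({} :: (complex ^ 'n) set)"
    using exists_unit_vector by auto
  moreover have "continuous_on (sphere 0 1) (\<lambda>x. norm (A *v x))"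
    by (intro continuous_on_norm linear_continuous_on) simp
  ultimately have "\<exists>x\<in>sphere 0 1. \<forall>y\<in>sphere 0 1. norm (A *v y) \<le> norm (A *v x)"
    by (intro continuous_attains_sup compact_sphere)
  then obtain x where x: "norm x = 1" "\<And>y. norm y = 1 \<Longrightarrow> norm (A *v y) \<le> norm (A *v x)"
    by auto
  have "norm (A *v y) \<le> norm (A *v x) * norm y" for y
  proof (cases "y = 0")
    case False
    then have "norm (A *v ((1 / norm y) *\<^sub>R y)) \<le> norm (A *v x)"
      by (intro x) simp
    with False show ?thesis
      by (simp add: linear_scale[OF matrix_vector_mul_linear] field_simps)
  qed simp
  then have "spectral_norm A \<le> norm (A *v x)"
    by (rule spectral_norm_le)
  moreover have "norm (A *v x) \<le> spectral_norm A"
    using norm_matrix_vector_le[of A x] x(1) by simp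
  ultimately show ?thesis
    using x(1) by auto
qed

lemma cmod_quadratic_form_le_spectral_norm:
  assumes "norm x = 1"
  shows "cmod (cinner (A *v x) x) \<le> spectral_norm A"
  using cinner_Cauchy_Schwarz[of "A *v x" x] norm_matrix_vector_le[of A x] assms by simp

lemma numerical_radius_le_spectral_norm: "numerical_radius A \<le> spectral_norm A"
  unfolding numerical_radius_def
  by (rule cSUP_least) (use exists_unit_vector cmod_quadratic_form_le_spectral_norm in auto)

lemma cmod_quadratic_form_le: "cmod (cinner (A *v x) x) \<le> numerical_radius A * (norm x)\<^sup>2"
proof (cases "x = 0")
  case False
  define y where "y = complex_of_real (1 / norm x) *s x"
  have "norm y = 1"
    using False by (simp add: y_def norm_vector_scalar_mult norm_divide)
  have "cmod (cinner (A *v y) y) = cmod (cinner (A *v x) x) / (norm x)\<^sup>2"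
    by (simp add: y_def vector_scalar_commute cinner_scale_left cinner_scale_right norm_mult
        norm_divide power2_eq_square)
  moreover have "cmod (cinner (A *v y) y) \<le> numerical_radius A"
    unfolding numerical_radius_def
    by (rule cSUP_upper)
      (use \<open>norm y = 1\<close> cmod_quadratic_form_le_spectral_norm in \<open>auto intro!: bdd_aboveI2\<close>)
  ultimately show ?thesis
    using False by (simp add: divide_le_eq)
qed (simp add: cinner_def)

lemma numerical_radius_le:
  assumes "\<And>x. cmod (cinner (A *v x) x) \<le> b * (norm x)\<^sup>2"
  shows "numerical_radius A \<le> b"
  unfolding numerical_radius_def
proof (rule cSUP_least)
  show "{x :: complex ^ 'a. norm x = 1} \<noteq> {}"
    using exists_unit_vector by auto
  show "cmod (cinner (A *v x) x) \<le> b" if "x \<in> {x. norm x = 1}" for x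
    using assms[of x] that by simp
qed

lemma numerical_radius_nonneg: "0 \<le> numerical_radius A"
proof -
  obtain x :: "complex ^ 'a" where "norm x = 1"
    using exists_unit_vector by blast
  then show ?thesis
    using cmod_quadratic_form_le[of A x] norm_ge_zero[of "cinner (A *v x) x"] by (simp del: norm_ge_zero)
qed

section \<open>The shift inequality\<close>

lemma sum_cis_roots_of_unity:
  fixes d :: int and M :: nat
  assumes "\<bar>d\<bar> < int M"
  shows "(\<Sum>t<M. cis (2 * pi * d * real t / M)) = (if d = 0 then of_nat M else 0)"
proof (cases "d = 0")
  case False
  define z where "z = cis (2 * pi * d / M)"
  have M: "M > 0"
    using assms by simp
  have "z ^ M = 1"
    using M cis_multiple_2pi[of "of_int d"] by (simp add: z_def Complex.DeMoivre del: cis_multiple_2pi)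
  have "z \<noteq> 1"
  proof
    assume "z = 1"
    then have "cos (2 * pi * d / M) = 1"
      by (metis z_def cis.sel(1) one_complex.sel(1))
    then obtain n :: int where "2 * pi * d / M = real_of_int n * 2 * pi"
      unfolding cos_one_2pi_int by blast
    then have "real_of_int d = of_int (n * int M)"
      using M by (simp add: field_simps)
    then have "d = n * int M"
      by (simp only: of_int_eq_iff)
    with assms False show False
      by (simp add: abs_mult)
  qed
  have "cis (2 * pi * d * t / M) = z ^ t" for t :: nat
    by (simp add: z_def Complex.DeMoivre mult_ac)
  then show ?thesis
    using \<open>z ^ M = 1\<close> \<open>z \<noteq> 1\<close> False by (simp add: geometric_sum)
qed simp

text \<open>The values at the \<open>M\<close>-th roots of unity of the trigonometric polynomial with coefficients
  \<open>g 0, \<dots>, g N\<close>.\<close>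

definition fourier_sample :: "(nat \<Rightarrow> complex ^ 'n) \<Rightarrow> nat \<Rightarrow> nat \<Rightarrow> nat \<Rightarrow> complex ^ 'n" where
  "fourier_sample g N M t = (\<Sum>k\<le>N. cis (- (2 * pi * k * t / M)) *s g k)"

text \<open>Expanding the form, the pair \<open>(k, l)\<close> carries the character \<open>t \<mapsto> cis (2 \<pi> (l + r - k) t / M)\<close>,
  whose sum over \<open>t\<close> vanishes unless \<open>M\<close> divides \<open>l + r - k\<close>. The bound on \<open>M\<close> keeps this difference
  strictly between \<open>-M\<close> and \<open>M\<close>, so only \<open>k = l + r\<close> survives: there is no wrap-around.\<close>

lemma fourier_sample_quadratic_form:
  fixes N r M :: nat
  assumes "N + r < M"
  shows "(\<Sum>t<M. cis (2 * pi * r * t / M) *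
            cinner (A *v fourier_sample g N M t) (fourier_sample g N M t)) =
         of_nat M * (\<Sum>l\<le>N. if l + r \<le> N then cinner (A *v g (l + r)) (g l) else 0)"
    (is "?L = _")
proof -
  have ph: "cis (2 * pi * r * t / M) * (cis (- (2 * pi * k * t / M)) * cnj (cis (- (2 * pi * l * t / M))))
      = cis (2 * pi * (int l + int r - int k) * t / M)" for t k l :: nat
    by (simp add: cis_mult cis_cnj algebra_simps add_divide_distrib diff_divide_distrib)
  have "?L = (\<Sum>t<M. \<Sum>l\<le>N. \<Sum>k\<le>N.
      cis (2 * pi * (int l + int r - int k) * t / M) * cinner (A *v g k) (g l))"
    unfolding fourier_sample_def ph[symmetric]
    by (simp add: matrix_vector_sum vector_scalar_commute cinner_sum_left cinner_sum_right
        cinner_scale_left cinner_scale_right sum_distrib_left mult_ac)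
  also have "\<dots> = (\<Sum>l\<le>N. \<Sum>k\<le>N. \<Sum>t<M.
      cis (2 * pi * (int l + int r - int k) * t / M) * cinner (A *v g k) (g l))"
    by (subst sum.swap, rule sum.cong[OF refl], rule sum.swap)
  also have "\<dots> = (\<Sum>l\<le>N. \<Sum>k\<le>N.
      of_nat M * (if k = l + r then cinner (A *v g k) (g l) else 0))"
  proof (intro sum.cong refl)
    fix l k assume lk: "l \<in> {..N}" "k \<in> {..N}"
    have "\<bar>int l + int r - int k\<bar> < int M"
      using lk assms by auto
    from sum_cis_roots_of_unity[OF this]
    show "(\<Sum>t<M. cis (2 * pi * (int l + int r - int k) * t / M) * cinner (A *v g k) (g l))
        = of_nat M * (if k = l + r then cinner (A *v g k) (g l) else 0)"
      unfolding sum_distrib_right[symmetric] by auto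
  qed
  finally show ?thesis
    by (simp flip: sum_distrib_left)
qed

text \<open>With weight \<open>\<zeta>\<close> the average of the forms of \<open>A\<close> extracts the first off-diagonal; without weight,
  and for the identity matrix, it is Parseval's identity for the norms. The definition of \<open>w(A)\<close>
  compares the two averages term by term.\<close>

lemma cmod_sum_shift_le:
  "cmod (\<Sum>k<N. cinner (A *v g (Suc k)) (g k)) \<le> numerical_radius A * (\<Sum>k\<le>N. (norm (g k))\<^sup>2)"
    (is "cmod ?S \<le> ?w * ?Q")
proof -
  \<comment> \<open>The least number of nodes for which neither \<open>r = 0\<close> nor \<open>r = 1\<close> wraps around.\<close>
  define M where "M = N + 2"
  define F where "F = fourier_sample g N M"
  have "(\<Sum>l\<le>N. if l + 1 \<le> N then cinner (A *v g (l + 1)) (g l) else 0) = ?S"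
    by (rule sum.mono_neutral_cong_right) auto
  then have S: "(\<Sum>t<M. cis (2 * pi * t / M) * cinner (A *v F t) (F t)) = of_nat M * ?S"
    using fourier_sample_quadratic_form[of N 1 M A g] by (simp add: M_def F_def)
  have "(\<Sum>t<M. cinner (F t) (F t)) = of_nat M * (\<Sum>l\<le>N. cinner (g l) (g l))"
    using fourier_sample_quadratic_form[of N 0 M "mat 1" g] by (simp add: M_def F_def)
  then have "complex_of_real (\<Sum>t<M. (norm (F t))\<^sup>2) = complex_of_real (M * ?Q)"
    by (simp add: cinner_self)
  then have Q: "(\<Sum>t<M. (norm (F t))\<^sup>2) = M * ?Q"
    by (simp only: of_real_eq_iff)
  have "M * cmod ?S = cmod (\<Sum>t<M. cis (2 * pi * t / M) * cinner (A *v F t) (F t))"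
    by (simp add: S norm_mult)
  also have "\<dots> \<le> (\<Sum>t<M. cmod (cinner (A *v F t) (F t)))"
    by (rule order_trans[OF norm_sum]) (simp add: norm_mult)
  also have "\<dots> \<le> (\<Sum>t<M. ?w * (norm (F t))\<^sup>2)"
    by (intro sum_mono cmod_quadratic_form_le)
  also have "\<dots> = M * (?w * ?Q)"
    by (simp add: Q flip: sum_distrib_left)
  finally show ?thesis
    by (simp add: M_def)
qed

lemma le_if_asymptotically_le:
  fixes c d :: real
  assumes "\<And>N :: nat. real N * c \<le> (real N + 1) * d"
  shows "c \<le> d"
proof (rule ccontr)
  assume "\<not> c \<le> d"
  then obtain N :: nat where "d < N * (c - d)"
    using ex_less_of_nat_mult[of "c - d" d] by auto
  with assms[of N] show False
    by (simp add: algebra_simps)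
qed

section \<open>Comparison of the spectral norm with the numerical radius\<close>

lemma spectral_norm_le_twice_numerical_radius: "spectral_norm A \<le> 2 * numerical_radius A"
proof (rule ccontr)
  assume *: "\<not> ?thesis"
  obtain x where x: "norm x = 1" "norm (A *v x) = spectral_norm A"
    using spectral_norm_attained by blast
  define s where "s = spectral_norm A"
  have "s > 0"
    using * numerical_radius_nonneg[of A] by (simp add: s_def)
  define y where "y = complex_of_real (1 / s) *s (A *v x)"
  have "norm y = 1"
    using x \<open>s > 0\<close> by (simp add: y_def s_def norm_vector_scalar_mult norm_divide)
  have "cinner (A *v x) y = of_real s"
    using x \<open>s > 0\<close> by (simp add: y_def s_def cinner_scale_right cinner_self power2_eq_square)
  then show False
    using cmod_sum_shift_le[of A "\<lambda>k. if k = 0 then y else x" 1] * x \<open>norm y = 1\<close> \<open>s > 0\<close>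
    by (simp add: s_def)
qed

primrec orbit :: "complex ^ 'n ^ 'n \<Rightarrow> complex ^ 'n \<Rightarrow> nat \<Rightarrow> complex ^ 'n" where
  "orbit A x 0 = x"
| "orbit A x (Suc k) = A *v orbit A x k"

lemma norm_conj_transpose_normal:
  assumes "normal_matrix A"
  shows "norm (conj_transpose A *v x) = norm (A *v x)"
proof -
  have "cinner (A *v x) (A *v x) = cinner x (conj_transpose A *v (A *v x))"
    by (rule cinner_conj_transpose)
  also have "\<dots> = cinner x (A *v (conj_transpose A *v x))"
    using assms by (simp add: normal_matrix_def matrix_vector_mul_assoc)
  also have "\<dots> = cinner (conj_transpose A *v x) (conj_transpose A *v x)"
    by (metis cinner_conj_transpose cnj_cinner)
  finally have "(norm (A *v x))\<^sup>2 = (norm (conj_transpose A *v x))\<^sup>2"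
    by (simp only: cinner_self of_real_eq_iff)
  then show ?thesis
    by (simp)
qed

text \<open>For a normal matrix \<open>\<parallel>A\<^sup>* y\<parallel> = \<parallel>A y\<parallel>\<close>, which makes \<open>a k = \<parallel>A^k x\<parallel>\<close> log-convex:
  \<open>(a (k + 1))\<^sup>2 = \<langle>A^k x, A\<^sup>* A^(k + 1) x\<rangle> \<le> a k * a (k + 2)\<close>. Starting with the largest possible ratio \<open>\<parallel>A\<parallel>\<close>, the sequence must
  keep it.\<close>

lemma norm_orbit_normal:
  assumes "normal_matrix A" and x: "norm x = 1" "norm (A *v x) = spectral_norm A"
    and s: "spectral_norm A > 0"
  shows "norm (orbit A x k) = spectral_norm A ^ k"
proof (induction k rule: induct_nat_012)
  case (ge2 k)
  let ?s = "spectral_norm A" and ?a = "\<lambda>k. norm (orbit A x k)"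
  have "complex_of_real ((?a (Suc k))\<^sup>2) = cinner (orbit A x k) (conj_transpose A *v orbit A x (Suc k))"
    using cinner_conj_transpose[of A "orbit A x k" "orbit A x (Suc k)"] by (simp add: cinner_self)
  then have "(?a (Suc k))\<^sup>2 = cmod (cinner (orbit A x k) (conj_transpose A *v orbit A x (Suc k)))"
    by (metis abs_power2 norm_of_real)
  also have "\<dots> \<le> ?a k * norm (conj_transpose A *v orbit A x (Suc k))"
    by (rule cinner_Cauchy_Schwarz)
  also have "\<dots> = ?a k * ?a (Suc (Suc k))"
    using assms(1) by (simp add: norm_conj_transpose_normal)
  finally have "?s ^ k * ?s ^ Suc (Suc k) \<le> ?s ^ k * ?a (Suc (Suc k))"
    unfolding ge2 by (simp add: power2_eq_square mult_ac)
  then have "?s ^ Suc (Suc k) \<le> ?a (Suc (Suc k))"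
    using s by (simp del: power_Suc)
  moreover have "?a (Suc (Suc k)) \<le> ?s ^ Suc (Suc k)"
    using norm_matrix_vector_le[of A "orbit A x (Suc k)"] ge2 by simp
  ultimately show ?case
    by simp
qed (use x in auto)

text \<open>The orbit of a norming vector is run through backwards and rescaled to constant norm, so that
  \<open>A (g (k + 1))\<close> is exactly \<open>\<parallel>A\<parallel>\<close> times \<open>g k\<close>. The shift inequality then loses only the factor \<open>(N + 1) / N\<close>.\<close>

lemma numerical_radius_normal:
  assumes "normal_matrix A"
  shows "numerical_radius A = spectral_norm A"
proof (cases "spectral_norm A > 0")
  case False
  then show ?thesis
    using spectral_norm_nonneg[of A] numerical_radius_nonneg[of A]
      numerical_radius_le_spectral_norm[of A] by simp
next
  case True
  obtain x where x: "norm x = 1" "norm (A *v x) = spectral_norm A"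
    using spectral_norm_attained by blast
  let ?s = "spectral_norm A"
  have "?s \<le> numerical_radius A"
  proof (rule le_if_asymptotically_le)
    fix N :: nat
    define g where "g k = complex_of_real (?s ^ k) *s orbit A x (N - k)" for k
    have ng: "norm (g k) = ?s ^ N" if "k \<le> N" for k
      using that True
      by (simp add: g_def norm_vector_scalar_mult norm_orbit_normal[OF assms x True] norm_power
          flip: power_add)
    have "cinner (A *v g (Suc k)) (g k) = of_real (?s * (?s ^ N)\<^sup>2)" if "k < N" for k
    proof -
      have "A *v g (Suc k) = complex_of_real ?s *s g k"
        using that by (simp add: g_def vector_scalar_commute flip: orbit.simps(2) Suc_diff_le)
      then show ?thesis
        using ng[of k] that by (simp add: cinner_scale_left cinner_self)
    qed
    then have "(\<Sum>k<N. cinner (A *v g (Suc k)) (g k)) = (\<Sum>k<N. of_real (?s * (?s ^ N)\<^sup>2))"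
      by simp
    also have "\<dots> = of_real (N * (?s * (?s ^ N)\<^sup>2))"
      by simp
    finally have "N * (?s * (?s ^ N)\<^sup>2) \<le> numerical_radius A * (\<Sum>k\<le>N. (norm (g k))\<^sup>2)"
      using cmod_sum_shift_le[of A g N] True by (simp del: of_real_mult of_nat_mult of_real_power)
    also have "(\<Sum>k\<le>N. (norm (g k))\<^sup>2) = (real N + 1) * (?s ^ N)\<^sup>2"
      by (simp add: ng)
    finally have "(real N * ?s) * (?s ^ N)\<^sup>2 \<le> ((real N + 1) * numerical_radius A) * (?s ^ N)\<^sup>2"
      by (simp add: mult_ac)
    then show "real N * ?s \<le> (real N + 1) * numerical_radius A"
      using True by simp
  qed
  then show ?thesis
    using numerical_radius_le_spectral_norm[of A] by simp
qed

section \<open>Entrywise product with an isometry\<close>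

definition hadamard :: "complex ^ 'n ^ 'n \<Rightarrow> complex ^ 'n ^ 'n \<Rightarrow> complex ^ 'n ^ 'n" where
  "hadamard A B = (\<chi> i j. A $ i $ j * B $ i $ j)"

lemma cinner_hadamard:
  "cinner (hadamard A B *v x) y = (\<Sum>i\<in>UNIV. \<Sum>j\<in>UNIV. A $ i $ j * B $ i $ j * x $ j * cnj (y $ i))"
  by (simp add: cinner_matrix_vector hadamard_def)

lemma cinner_axis_right: "cinner x (axis i 1) = x $ i"
  by (simp add: cinner_def axis_def if_distrib cong: if_cong)

lemma matrix_vector_axis: "A *v axis j 1 = column j A"
  for A :: "complex ^ 'n ^ 'm"
  by (simp add: vec_eq_iff matrix_vector_mult_def axis_def column_def if_distrib cong: if_cong)

text \<open>Polarisation of the real inner product gives the real part; applied to \<open>\<i> *s x\<close> it gives the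
  imaginary part.\<close>

lemma inner_isometry:
  assumes "\<And>x. norm (U *v x) = norm x"
  shows "cinner (U *v x) (U *v y) = cinner x y"
proof -
  have re: "inner (U *v a) (U *v b) = inner a b" for a b
    using assms[of "a + b"] assms[of a] assms[of b]
    by (simp add: matrix_vector_right_distrib norm_eq_sqrt_inner inner_add inner_commute)
  have "Re (\<i> * cinner (U *v x) (U *v y)) = Re (\<i> * cinner x y)"
    using re[of "\<i> *s x" y]
    by (simp only: vector_scalar_commute cinner_scale_left flip: Re_cinner)
  with re[of x y] show ?thesis
    by (simp add: complex_eq_iff flip: Re_cinner)
qed

text \<open>This is \<open>w(A \<otimes> U) \<le> w(A)\<close>, compressed to the diagonal and written in coordinates. The vector
  \<open>\<Sum>j. x\<^sub>j e\<^sub>j \<otimes> U^k e\<^sub>j\<close> of the tensor product is the family \<open>g h k\<close>, indexed by the coordinate \<open>h\<close> of the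
  second factor; the shift inequality is used for each \<open>h\<close> and summed.\<close>

lemma hadamard_isometry_quadratic_form_le:
  assumes iso: "\<And>x. norm (U *v x) = norm x"
  shows "cmod (cinner (hadamard A U *v x) x) \<le> numerical_radius A * (norm x)\<^sup>2"
proof (rule le_if_asymptotically_le)
  fix N :: nat
  define g where "g h k = (\<chi> j. x $ j * orbit U (axis j 1) k $ h)" for h k
  have norm_orbit: "norm (orbit U (axis j 1) k) = 1" for j k
    by (induction k) (simp_all add: iso norm_axis_one)
  have orbit_shift: "cinner (orbit U (axis j 1) (Suc k)) (orbit U (axis i 1) k) = U $ i $ j" for i j k
    by (induction k)
      (simp_all add: inner_isometry[OF iso] cinner_axis_right matrix_vector_axis column_def)
  have "(\<Sum>h\<in>UNIV. (norm (g h k))\<^sup>2) = (norm x)\<^sup>2" for k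
  proof -
    have "(\<Sum>h\<in>UNIV. (norm (g h k))\<^sup>2)
        = (\<Sum>j\<in>UNIV. (cmod (x $ j))\<^sup>2 * (norm (orbit U (axis j 1) k))\<^sup>2)"
      unfolding norm_power2_vec g_def
      by (subst sum.swap) (simp add: norm_mult power_mult_distrib sum_distrib_left)
    then show ?thesis
      by (simp add: norm_orbit norm_power2_vec[of x])
  qed
  note norms = this
  have forms: "(\<Sum>h\<in>UNIV. cinner (A *v g h (Suc k)) (g h k)) = cinner (hadamard A U *v x) x" for k
  proof -
    have "(\<Sum>h\<in>UNIV. cinner (A *v g h (Suc k)) (g h k))
        = (\<Sum>i\<in>UNIV. \<Sum>j\<in>UNIV. \<Sum>h\<in>UNIV. A $ i $ j * x $ j * cnj (x $ i) *
            (orbit U (axis j 1) (Suc k) $ h * cnj (orbit U (axis i 1) k $ h)))"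
      unfolding cinner_matrix_vector g_def
      by (subst sum.swap, rule sum.cong[OF refl], subst sum.swap) (simp add: mult_ac)
    also have "\<dots> = (\<Sum>i\<in>UNIV. \<Sum>j\<in>UNIV. A $ i $ j * x $ j * cnj (x $ i) * U $ i $ j)"
      by (simp only: orbit_shift flip: sum_distrib_left cinner_def)
    finally show ?thesis
      by (simp add: cinner_hadamard mult_ac)
  qed
  have "real N * cmod (cinner (hadamard A U *v x) x)
      = cmod (\<Sum>k<N. \<Sum>h\<in>UNIV. cinner (A *v g h (Suc k)) (g h k))"
    by (simp add: forms norm_mult)
  also have "\<dots> = cmod (\<Sum>h\<in>UNIV. \<Sum>k<N. cinner (A *v g h (Suc k)) (g h k))"
    by (subst sum.swap) (rule refl)
  also have "\<dots> \<le> (\<Sum>h\<in>UNIV. numerical_radius A * (\<Sum>k\<le>N. (norm (g h k))\<^sup>2))"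
    by (intro order_trans[OF norm_sum] sum_mono cmod_sum_shift_le)
  also have "\<dots> = numerical_radius A * (\<Sum>k\<le>N. \<Sum>h\<in>UNIV. (norm (g h k))\<^sup>2)"
    unfolding sum_distrib_left[symmetric] by (subst sum.swap) (rule refl)
  finally show "real N * cmod (cinner (hadamard A U *v x) x)
      \<le> (real N + 1) * (numerical_radius A * (norm x)\<^sup>2)"
    by (simp add: norms mult_ac add_ac)
qed

section \<open>Extreme contractions are isometries\<close>

definition contractions :: "(complex ^ 'n ^ 'n) set" where
  "contractions = {B. \<forall>x. norm (B *v x) \<le> norm x}"

lemma convex_contractions: "convex contractions"
proof (rule convexI)
  fix B C :: "complex ^ 'n ^ 'n" and u v :: real
  assume BC: "B \<in> contractions" "C \<in> contractions" and uv: "0 \<le> u" "0 \<le> v" "u + v = 1"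
  show "u *\<^sub>R B + v *\<^sub>R C \<in> contractions"
    unfolding contractions_def
  proof (intro CollectI allI)
    fix x
    have "(u *\<^sub>R B + v *\<^sub>R C) *v x = u *\<^sub>R (B *v x) + v *\<^sub>R (C *v x)"
      by (simp add: vec_eq_iff matrix_vector_mult_def distrib_right sum.distrib scaleR_right.sum)
    also have "norm \<dots> \<le> u * norm (B *v x) + v * norm (C *v x)"
      using uv by (intro norm_triangle_le) simp
    also have "\<dots> \<le> u * norm x + v * norm x"
      using BC uv by (intro add_mono mult_left_mono) (auto simp: contractions_def)
    also have "\<dots> = norm x"
      using uv by (metis distrib_right mult_1)
    finally show "norm ((u *\<^sub>R B + v *\<^sub>R C) *v x) \<le> norm x" .
  qed
qed

lemma scaleR_matrix_vector_mult: "(a *\<^sub>R B) *v x = a *\<^sub>R (B *v x)"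
  for B :: "complex ^ 'n ^ 'm"
  by (simp add: vec_eq_iff matrix_vector_mult_def scaleR_right.sum)

text \<open>The norm of the matrix type is the Frobenius norm.\<close>

lemma frobenius_norm_columns: "(norm M)\<^sup>2 = (\<Sum>j\<in>UNIV. (norm (column j M))\<^sup>2)"
  for M :: "complex ^ 'n ^ 'm"
  unfolding norm_power2_vec column_def by (subst sum.swap) simp

lemma compact_contractions: "compact (contractions :: (complex ^ 'n ^ 'n) set)"
proof -
  have "closed (contractions :: (complex ^ 'n ^ 'n) set)"
    unfolding contractions_def matrix_vector_mult_def
    by (intro closed_Collect_all closed_Collect_le continuous_intros continuous_on_norm)
  moreover have "bounded (contractions :: (complex ^ 'n ^ 'n) set)"
  proof (rule boundedI)
    fix B :: "complex ^ 'n ^ 'n"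
    assume B: "B \<in> contractions"
    have "norm (column j B) \<le> 1" for j
      using B norm_axis_one by (metis (mono_tags, lifting) contractions_def matrix_vector_axis mem_Collect_eq)
    then have "(norm B)\<^sup>2 \<le> (\<Sum>j\<in>(UNIV :: 'n set). 1)"
      unfolding frobenius_norm_columns by (intro sum_mono) (simp add: power_le_one)
    then show "norm B \<le> sqrt CARD('n)"
      by (simp add: real_le_rsqrt)
  qed
  ultimately show ?thesis
    using compact_eq_bounded_closed by blast
qed

text \<open>x\<close>
text \<open>The quadratic form \<open>z \<mapsto> \<parallel>z\<parallel>\<^sup>2 - \<parallel>B z\<parallel>\<^sup>2\<close> is nonnegative and vanishes at \<open>x\<close>, so its derivative at
  \<open>x\<close> vanishes in every direction \<open>y\<close>.\<close>

lemma contraction_isometric_imp_inner_eq: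
  assumes B: "B \<in> contractions" and x: "norm (B *v x) = norm x"
  shows "inner (B *v x) (B *v y) = inner x y"
proof -
  define p where "p = inner x y - inner (B *v x) (B *v y)"
  define q where "q = (norm y)\<^sup>2 - (norm (B *v y))\<^sup>2"
  have contr: "norm (B *v z) \<le> norm z" for z
    using B by (simp add: contractions_def)
  have "q \<ge> 0"
    using contr[of y] by (simp add: q_def power_mono)
  have parabola: "0 \<le> 2 * t * p + t\<^sup>2 * q" for t
  proof -
    have "(norm (B *v (x + t *\<^sub>R y)))\<^sup>2 \<le> (norm (x + t *\<^sub>R y))\<^sup>2"
      using contr by (intro power_mono) auto
    moreover have "inner (B *v x) (B *v x) = inner x x"
      using x by (simp add: norm_eq)
    ultimately show ?thesis
      unfolding p_def q_def power2_norm_eq_inner matrix_vector_right_distrib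
        linear_scale[OF matrix_vector_mul_linear]
      by (simp add: inner_add inner_commute power2_eq_square algebra_simps)
  qed
  \<comment> \<open>The parabola is lowest at \<open>- p / q\<close>; the denominator \<open>q + 1\<close> also covers \<open>q = 0\<close>.\<close>
  define t where "t = p / (q + 1)"
  have p: "p = t * (q + 1)"
    using \<open>q \<ge> 0\<close> by (simp add: t_def)
  have "2 * (- t) * p + (- t)\<^sup>2 * q = - (t\<^sup>2 * (q + 2))"
    unfolding p by (simp add: power2_eq_square algebra_simps)
  with parabola[of "- t"] have "t\<^sup>2 * (q + 2) \<le> 0"
    by simp
  with \<open>q \<ge> 0\<close> have "t = 0"
    by (simp add: mult_le_0_iff)
  then have "p = 0"
    by (simp add: p)
  then show ?thesis
    by (simp add: p_def)
qed

text \<open>Let \<open>K\<close> be the subspace on which \<open>B\<close> is isometric. If it is proper, then \<open>B\<close> is strictly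
  contracting on \<open>K\<^sup>\<bottom>\<close> by compactness, and maps \<open>K\<^sup>\<bottom>\<close> into \<open>(B K)\<^sup>\<bottom>\<close>, a nonzero space by dimension. There
  is room to add and to subtract a small rank-one operator \<open>D\<close> from \<open>K\<^sup>\<bottom>\<close> to \<open>(B K)\<^sup>\<bottom>\<close>, so \<open>B\<close> is a
  proper midpoint of two contractions.\<close>

lemma extreme_contraction_isometry:
  fixes B :: "complex ^ 'n ^ 'n"
  assumes ext: "B extreme_point_of contractions"
  shows "norm (B *v x) = norm x"
proof -
  have contr: "norm (B *v x) \<le> norm x" for x
    using ext by (auto simp: extreme_point_of_def contractions_def)
  \<comment> \<open>The vectors with \<open>\<parallel>B x\<parallel> = \<parallel>x\<parallel>\<close>, written as a condition that is linear in \<open>x\<close>.\<close>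
  define K where "K = {x. \<forall>y. inner (B *v x) (B *v y) = inner x y}"
  have "subspace K"
    by (auto simp: K_def subspace_def matrix_vector_right_distrib inner_add_left
        linear_scale[OF matrix_vector_mul_linear])
  \<comment> \<open>Hence orthogonality to \<open>K\<close> means the same for the real and for the complex form.\<close>
  have scaleK: "c *s k \<in> K" if "k \<in> K" for c k
    unfolding K_def
  proof (intro CollectI allI)
    fix y
    have adj: "inner (c *s a) b = inner a (cnj c *s b)" for a b :: "complex ^ 'n"
      by (simp add: cinner_scale_left cinner_scale_right flip: Re_cinner)
    show "inner (B *v (c *s k)) (B *v y) = inner (c *s k) y"
      using that unfolding K_def vector_scalar_commute adj
      by (simp flip: vector_scalar_commute)
  qed
  have "K = UNIV"
  proof (rule ccontr)
    assume "K \<noteq> UNIV"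
    then have dimK: "dim K < DIM(complex ^ 'n)"
      using \<open>subspace K\<close> by (metis dim_eq_full dim_subset_UNIV le_neq_implies_less span_eq_iff)
    obtain u where u: "u \<noteq> 0" "\<And>k. k \<in> K \<Longrightarrow> inner u k = 0"
      using orthogonal_to_subspace_exists[OF dimK] unfolding orthogonal_def
      by (metis span_base)
    have "dim ((*v) B ` K) < DIM(complex ^ 'n)"
      using dim_image_le[of "(*v) B" K] dimK by simp
    then obtain w where w: "w \<noteq> 0" "\<And>k. k \<in> K \<Longrightarrow> inner w (B *v k) = 0"
      using orthogonal_to_subspace_exists[of "(*v) B ` K"] unfolding orthogonal_def
      by (metis imageI span_base)
    define T where "T = {y. norm y = 1 \<and> (\<forall>k\<in>K. inner y k = 0)}"
    have "T = sphere 0 1 \<inter> (\<Inter>k\<in>K. {y. inner y k = 0})"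
      by (auto simp: T_def)
    then have "compact T"
      by (auto intro!: compact_Int_closed closed_INT closed_Collect_eq continuous_intros)
    moreover have "u /\<^sub>R norm u \<in> T"
      using u by (simp add: T_def)
    moreover have "continuous_on T (\<lambda>y. norm (B *v y))"
      by (intro continuous_on_norm linear_continuous_on) simp
    ultimately obtain z where z: "z \<in> T" "\<And>y. y \<in> T \<Longrightarrow> norm (B *v y) \<le> norm (B *v z)"
      using continuous_attains_sup[of T "\<lambda>y. norm (B *v y)"] by auto
    define r where "r = norm (B *v z)"
    have "r < 1"
    proof (rule ccontr)
      assume "\<not> r < 1"
      then have "norm (B *v z) = norm z"
        using contr[of z] z(1) by (simp add: r_def T_def)
      then have "z \<in> K"
        using ext contraction_isometric_imp_inner_eq by (auto simp: K_def extreme_point_of_def)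
      with z(1) have "inner z z = 0"
        by (auto simp: T_def)
      with z(1) show False
        by (simp add: T_def)
    qed
    have gap: "norm (B *v y) \<le> r * norm y" if "\<And>k. k \<in> K \<Longrightarrow> inner y k = 0" for y
    proof (cases "y = 0")
      case False
      then have "y /\<^sub>R norm y \<in> T"
        using that by (simp add: T_def)
      from z(2)[OF this] False show ?thesis
        by (simp add: r_def linear_scale[OF matrix_vector_mul_linear] field_simps)
    qed simp
    \<comment> \<open>This scale makes the rank-one operator below have norm \<open>1 - r\<close>, the slack left by \<open>B\<close>.\<close>
    define c where "c = (1 - r) / (norm u * norm w)"
    have "c > 0"
      using \<open>r < 1\<close> u w by (simp add: c_def)
    define D :: "complex ^ 'n ^ 'n" where "D = (\<chi> i j. of_real c * w $ i * cnj (u $ j))"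
    have D: "D *v x = (of_real c * cinner x u) *s w" for x
      by (simp add: vec_eq_iff D_def matrix_vector_mult_def cinner_def sum_distrib_left
          sum_distrib_right mult_ac)
    have D_K: "D *v k = 0" if "k \<in> K" for k
    proof -
      have "inner (cnj (cinner k u) *s k) u = 0"
        using u(2)[OF scaleK[OF that]] by (simp add: inner_commute)
      moreover have "cinner (cnj (cinner k u) *s k) u = of_real ((cmod (cinner k u))\<^sup>2)"
        unfolding cinner_scale_left complex_norm_square by (rule mult.commute)
      ultimately have "(cmod (cinner k u))\<^sup>2 = 0"
        by (metis Re_cinner Re_complex_of_real)
      then show ?thesis
        by (simp add: D)
    qed
    have D_orth: "inner (D *v y) (B *v k) = 0" if "k \<in> K" for y k
    proof -
      let ?a = "of_real c * cinner y u"
      have "inner (?a *s w) (B *v k) = inner w (B *v (cnj ?a *s k))"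
        by (simp add: vector_scalar_commute cinner_scale_left cinner_scale_right flip: Re_cinner)
      then show ?thesis
        using w(2)[OF scaleK[OF that]] by (simp add: D)
    qed
    have norm_D: "norm (D *v y) \<le> (1 - r) * norm y" for y
    proof -
      have "norm (D *v y) = c * norm w * cmod (cinner y u)"
        using \<open>c > 0\<close> by (simp add: D norm_vector_scalar_mult norm_mult)
      also have "\<dots> \<le> c * norm w * (norm y * norm u)"
        using \<open>c > 0\<close> by (intro mult_left_mono cinner_Cauchy_Schwarz) simp
      also have "\<dots> = (1 - r) * norm y"
        using u w by (simp add: c_def)
      finally show ?thesis .
    qed
    have perturb: "B + e *\<^sub>R D \<in> contractions" if e: "\<bar>e\<bar> = 1" for e :: real
      unfolding contractions_def
    proof (intro CollectI allI)
      fix x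
      obtain k y where k: "k \<in> K" and y: "\<And>k. k \<in> K \<Longrightarrow> inner y k = 0" and x: "x = k + y"
        using orthogonal_subspace_decomp_exists[of K x] \<open>subspace K\<close>
        unfolding orthogonal_def by (metis span_eq_iff)
      let ?v = "B *v y + e *\<^sub>R (D *v y)"
      have eq: "(B + e *\<^sub>R D) *v x = B *v k + ?v"
        unfolding x using D_K[OF k]
        by (simp add: matrix_vector_mult_add_rdistrib matrix_vector_right_distrib
            scaleR_matrix_vector_mult)
      have "inner (B *v k) (B *v y) = 0"
        using k y[OF k] by (simp add: K_def inner_commute[of k])
      then have orth: "inner (B *v k) ?v = 0"
        using D_orth[OF k, of y] by (simp add: inner_add_right inner_commute)
      have "norm ?v \<le> norm y"
        using gap[OF y] norm_D[of y] e
        by (intro norm_triangle_le) (simp add: algebra_simps)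
      have "(norm ((B + e *\<^sub>R D) *v x))\<^sup>2 = (norm (B *v k))\<^sup>2 + (norm ?v)\<^sup>2"
        unfolding eq using orth by (simp add: norm_add_Pythagorean orthogonal_def)
      also have "\<dots> \<le> (norm k)\<^sup>2 + (norm y)\<^sup>2"
        using \<open>norm ?v \<le> norm y\<close> contr by (intro add_mono power_mono) auto
      also have "\<dots> = (norm x)\<^sup>2"
        unfolding x using y[OF k]
        by (simp add: norm_add_Pythagorean orthogonal_def inner_commute)
      finally show "norm ((B + e *\<^sub>R D) *v x) \<le> norm x"
        by (simp add: power2_le_iff_abs_le)
    qed
    have "D \<noteq> 0"
    proof
      assume "D = 0"
      then have "(of_real c * cinner u u) *s w = 0"
        by (metis D matrix_vector_mult_0)
      with u w \<open>c > 0\<close> show False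
        by (simp add: cinner_self)
    qed
    then have "B + D \<noteq> B - D"
      by (simp add: eq_diff_eq add.assoc flip: scaleR_2)
    moreover have "B = midpoint (B + D) (B - D)"
      by (simp add: midpoint_def flip: scaleR_2)
    ultimately have "B \<in> open_segment (B + D) (B - D)"
      by (metis midpoint_in_open_segment)
    moreover have "B + D \<in> contractions" "B - D \<in> contractions"
      using perturb[of 1] perturb[of "- 1"] by simp_all
    ultimately show False
      using ext unfolding extreme_point_of_def by blast
  qed
  then have "inner (B *v x) (B *v x) = inner x x"
    by (auto simp: K_def)
  then show ?thesis
    by (simp add: norm_eq_sqrt_inner)
qed

section \<open>Entrywise products: numerical radius and spectral norm\<close>

text \<open>For fixed \<open>A\<close> and \<open>x\<close> the matrices \<open>M\<close> with \<open>\<bar>\<langle>(A \<circ> M) x, x\<rangle>\<bar> \<le> w(A) \<parallel>x\<parallel>\<^sup>2\<close> form a convex set. It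
  contains the extreme contractions, hence all contractions, and \<open>B\<close> is a multiple of one.\<close>

lemma numerical_radius_hadamard_le:
  fixes A B :: "complex ^ 'n ^ 'n"
  shows "numerical_radius (hadamard A B) \<le> numerical_radius A * spectral_norm B"
proof (cases "spectral_norm B = 0")
  case True
  then have "B *v x = 0" for x
    using norm_matrix_vector_le[of B x] by simp
  then have "column j B = 0" for j
    by (simp flip: matrix_vector_axis)
  then have "hadamard A B = 0"
    by (simp add: vec_eq_iff hadamard_def column_def)
  then have "numerical_radius (hadamard A B) \<le> 0"
    by (intro numerical_radius_le) (simp add: cinner_def)
  then show ?thesis
    using True by simp
next
  case False
  then have s: "spectral_norm B > 0"
    using spectral_norm_nonneg[of B] by simp
  define C where "C = (1 / spectral_norm B) *\<^sub>R B"
  have C: "C \<in> contractions"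
    using norm_matrix_vector_le[of B] s
    by (simp add: contractions_def C_def scaleR_matrix_vector_mult field_simps)
  show ?thesis
  proof (rule numerical_radius_le)
    fix x :: "complex ^ 'n"
    let ?S = "{M. cmod (cinner (hadamard A M *v x) x) \<le> numerical_radius A * (norm x)\<^sup>2}"
    have lin: "linear (\<lambda>M. cinner (hadamard A M *v x) x)"
      by (rule linearI)
        (simp_all add: cinner_hadamard algebra_simps sum.distrib scaleR_right.sum)
    have "?S = (\<lambda>M. cinner (hadamard A M *v x) x) -` cball 0 (numerical_radius A * (norm x)\<^sup>2)"
      by auto
    then have "convex ?S"
      using convex_linear_vimage[OF lin convex_cball] by simp
    moreover have "{U. U extreme_point_of contractions} \<subseteq> ?S"
      using hadamard_isometry_quadratic_form_le extreme_contraction_isometry by blast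
    ultimately have "convex hull {U. U extreme_point_of contractions} \<subseteq> ?S"
      by (intro hull_minimal)
    with C have "C \<in> ?S"
      using Krein_Milman_Minkowski[OF compact_contractions convex_contractions] by blast
    moreover have "cinner (hadamard A B *v x) x = spectral_norm B *\<^sub>R cinner (hadamard A C *v x) x"
      using linear_scale[OF lin, of "spectral_norm B" C] s by (simp add: C_def)
    ultimately show "cmod (cinner (hadamard A B *v x) x)
        \<le> numerical_radius A * spectral_norm B * (norm x)\<^sup>2"
      using s by (simp add: mult_ac)
  qed
qed

lemma norm_transpose: "norm (transpose M) = norm M"
  for M :: "complex ^ 'n ^ 'm"
proof -
  have "(norm (transpose M))\<^sup>2 = (norm M)\<^sup>2"
    unfolding frobenius_norm_columns[of M] norm_power2_vec[of "transpose M"]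
    by (simp add: column_def transpose_def)
  then show ?thesis
    by simp
qed

text \<open>The columns of the product are the images under \<open>A\<close> of the columns of \<open>M\<close>.\<close>

lemma frobenius_norm_matrix_mult_le: "norm (A ** M) \<le> spectral_norm A * norm M"
proof -
  have "column j (A ** M) = A *v column j M" for j
    by (simp add: vec_eq_iff column_def matrix_matrix_mult_def matrix_vector_mult_def)
  then have "(norm (A ** M))\<^sup>2 \<le> (\<Sum>j\<in>UNIV. (spectral_norm A * norm (column j M))\<^sup>2)"
    unfolding frobenius_norm_columns[of "A ** M"]
    by (intro sum_mono power_mono) (simp_all add: norm_matrix_vector_le)
  also have "\<dots> = (spectral_norm A * norm M)\<^sup>2"
    by (simp add: frobenius_norm_columns[of M] power_mult_distrib sum_distrib_left)
  finally show ?thesis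
    by (rule power2_le_imp_le) (simp add: spectral_norm_nonneg)
qed

text \<open>With \<open>X = diag(x)\<close>, the vector \<open>(A \<circ> B) x\<close> is the diagonal of \<open>A X B\<^sup>T = A (B X)\<^sup>T\<close>. Its norm is at
  most the Frobenius norm of that product, which is at most \<open>\<parallel>A\<parallel> \<parallel>B\<parallel>\<close> times the Frobenius norm
  \<open>\<parallel>x\<parallel>\<close> of \<open>X\<close>.\<close>

lemma spectral_norm_hadamard_le:
  fixes A B :: "complex ^ 'n ^ 'n"
  shows "spectral_norm (hadamard A B) \<le> spectral_norm A * spectral_norm B"
proof (rule spectral_norm_le)
  fix x :: "complex ^ 'n"
  define X :: "complex ^ 'n ^ 'n" where "X = (\<chi> i j. if i = j then x $ i else 0)"
  have X: "norm X = norm x"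
  proof -
    have "(norm (X $ i))\<^sup>2 = (norm (x $ i))\<^sup>2" for i
      unfolding norm_power2_vec[of "X $ i"]
      by (simp add: X_def if_distrib[of norm] if_distrib[of "\<lambda>a. a\<^sup>2"] cong: if_cong)
    then have "(norm X)\<^sup>2 = (norm x)\<^sup>2"
      unfolding norm_power2_vec[of X] norm_power2_vec[of x] by simp
    then show ?thesis
      by simp
  qed
  define P where "P = A ** transpose (B ** X)"
  have diag: "(hadamard A B *v x) $ i = P $ i $ i" for i
    by (simp add: P_def X_def hadamard_def matrix_vector_mult_def matrix_matrix_mult_def
        transpose_def if_distrib mult.assoc cong: if_cong)
  have "(norm (hadamard A B *v x))\<^sup>2 \<le> (\<Sum>i\<in>UNIV. (norm (P $ i))\<^sup>2)"
    unfolding norm_power2_vec[of "hadamard A B *v x"] diag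
    by (intro sum_mono power_mono Finite_Cartesian_Product.norm_nth_le) simp
  also have "\<dots> = (norm P)\<^sup>2"
    by (rule norm_power2_vec[symmetric])
  finally have "norm (hadamard A B *v x) \<le> norm P"
    by (rule power2_le_imp_le) simp
  also have "\<dots> \<le> spectral_norm A * norm (B ** X)"
    unfolding P_def by (metis frobenius_norm_matrix_mult_le norm_transpose)
  also have "\<dots> \<le> spectral_norm A * (spectral_norm B * norm x)"
    by (metis X frobenius_norm_matrix_mult_le mult_left_mono spectral_norm_nonneg)
  finally show "norm (hadamard A B *v x) \<le> spectral_norm A * spectral_norm B * norm x"
    by (simp add: mult_ac)
qed

section \<open>Entrywise powers\<close>

lemma hadamard_power_1: "hadamard_power A (Suc 0) = A"
  by (simp add: hadamard_power_def map_matrix_def vec_eq_iff)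

lemma hadamard_power_Suc: "hadamard_power A (Suc m) = hadamard A (hadamard_power A m)"
  by (simp add: hadamard_power_def hadamard_def map_matrix_def vec_eq_iff)

text \<open>The induction starts at the first power: the zeroth entrywise power is the all-ones matrix,
  of spectral norm \<open>n\<close>.\<close>

lemma spectral_norm_hadamard_power_le:
  "spectral_norm (hadamard_power A (Suc m)) \<le> spectral_norm A ^ Suc m"
proof (induction m)
  case (Suc m)
  have "spectral_norm (hadamard_power A (Suc (Suc m)))
      \<le> spectral_norm A * spectral_norm (hadamard_power A (Suc m))"
    unfolding hadamard_power_Suc[of A "Suc m"] by (rule spectral_norm_hadamard_le)
  also have "\<dots> \<le> spectral_norm A * spectral_norm A ^ Suc m"
    using Suc spectral_norm_nonneg by (rule mult_left_mono)
  finally show ?case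
    by simp
qed (simp add: hadamard_power_1)

lemma numerical_radius_hadamard_power_le:
  "numerical_radius (hadamard_power A (Suc m)) \<le> numerical_radius A * spectral_norm A ^ m"
proof (cases m)
  case 0
  then show ?thesis
    by (simp add: hadamard_power_1)
next
  case (Suc k)
  have "numerical_radius (hadamard_power A (Suc m))
      \<le> numerical_radius A * spectral_norm (hadamard_power A m)"
    unfolding hadamard_power_Suc by (rule numerical_radius_hadamard_le)
  also have "\<dots> \<le> numerical_radius A * spectral_norm A ^ m"
    unfolding Suc
    by (rule mult_left_mono[OF spectral_norm_hadamard_power_le numerical_radius_nonneg])
  finally show ?thesis .
qed

theorem proposition4p7:
  fixes A :: "complex ^ 'n ^ 'n" and m :: nat
  assumes "m \<ge> 1"
  shows
    "(numerical_radius (hadamard_power A m) \<le> numerical_radius A * spectral_norm A ^ (m - 1) \<and>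
      numerical_radius A * spectral_norm A ^ (m - 1) \<le> 2 ^ (m - 1) * numerical_radius A ^ m) \<and>
     ((normal_matrix A \<longrightarrow> numerical_radius A = spectral_norm A) \<and>
      (numerical_radius A = spectral_norm A \<longrightarrow>
        numerical_radius (hadamard_power A m) \<le> numerical_radius A ^ m)) \<and>
     (numerical_radius A = spectral_norm A \<and>
      numerical_radius (hadamard_power A m) = numerical_radius A ^ m \<longrightarrow>
        numerical_radius (hadamard_power A m) = spectral_norm (hadamard_power A m) \<and>
        spectral_norm (hadamard_power A m) = spectral_norm A ^ m \<and>
        spectral_norm A ^ m = numerical_radius A ^ m)"
proof -
  obtain k where m: "m = Suc k"
    using assms by (cases m) auto
  have power_bound: "numerical_radius (hadamard_power A m) \<le> numerical_radius A * spectral_norm A ^ (m - 1)"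
    using numerical_radius_hadamard_power_le[of A k] by (simp add: m)
  have "spectral_norm A ^ k \<le> (2 * numerical_radius A) ^ k"
    by (intro power_mono spectral_norm_le_twice_numerical_radius spectral_norm_nonneg)
  from mult_left_mono[OF this numerical_radius_nonneg[of A]]
  have two_power_bound:
    "numerical_radius A * spectral_norm A ^ (m - 1) \<le> 2 ^ (m - 1) * numerical_radius A ^ m"
    by (simp add: m power_mult_distrib mult_ac)
  have norm_bound: "spectral_norm (hadamard_power A m) \<le> spectral_norm A ^ m"
    unfolding m by (rule spectral_norm_hadamard_power_le)
  have radial: "numerical_radius (hadamard_power A m) \<le> numerical_radius A ^ m"
    if "numerical_radius A = spectral_norm A"
    using power_bound that by (simp add: m)
  show ?thesis
    using power_bound two_power_bound radial numerical_radius_normal[of A] norm_bound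
      numerical_radius_le_spectral_norm[of "hadamard_power A m"]
    by auto
qed

end
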